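(* Let $k$ be a field, let $q\in k^{\times}$ be not a root of unity, and let $n\ge 0$ be an integer. Let $P\subset A^{(n)}$ be a prime ideal such that $\langle x,x',\dots,x^{(n)}\rangle\subset P$. Then $P$ is of the form $$P=\langle x,x',\dots,x^{(n)},\varphi_1(y,y',\dots,y^{(n)}),\dots,\varphi_m(y,y',\dots,y^{(n)})\rangle,$$ where $\varphi_i(y,y',\dots,y^{(n)})\in k[y,y',\dots,y^{(n)}]$ for $i=1,\dots,m$ generate a prime ideal of the commutative polynomial ring $k[y,y',\dots,y^{(n)}]$.
   Context: Let $B^{(n)}=k\langle x,x',\dots,x^{(n)},y,y',\dots,y^{(n)}\rangle$ be the free associative (noncommutative) unital $k$-algebra on the $2n+2$ indeterminates $x=x^{(0)},x'=x^{(1)},\dots,x^{(n)},y=y^{(0)},y'=y^{(1)},\dots,y^{(n)}$. Let $A^{(n)}$ be the quotient of $B^{(n)}$ by the two-sided ideal generated by all elements $x^{(i)}x^{(j)}-x^{(j)}x^{(i)}$, $\;y^{(i)}y^{(j)}-y^{(j)}y^{(i)}$, $\;y^{(i)}x^{(j)}-q\,x^{(j)}y^{(i)}$ for $0\le i,j\le n$. The variables $y,y',\dots,y^{(n)}$ commute with each other in $A^{(n)}$, so a polynomial in $k[y,y',\dots,y^{(n)}]$ defines an element of $A^{(n)}$. Ideals of $A^{(n)}$ are two-sided, and $\langle S\rangle$ denotes the two-sided ideal generated by a set $S$. An ideal $P$ is prime if $P\ne(1)$ and $ab\in P$ implies $a\in P$ or $b\in P$ for all elements $a,b$. *)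

theory Defs
  imports "HOL-Algebra.QuotRing" "HOL-Library.Poly_Mapping"
begin

text \<open>
  Words in an alphabet, as the free monoid written additively, so that
  \<open>'a word \<Rightarrow>\<^sub>0 'k\<close> with the convolution product of \<^typ>\<open>'a \<Rightarrow>\<^sub>0 'b\<close>
  is the free associative unital algebra.
\<close>

datatype 'a word = Word (letters: "'a list")

instantiation word :: (type) monoid_add
begin

definition zero_word :: "'a word" where
  "zero_word = Word []"

definition plus_word :: "'a word \<Rightarrow> 'a word \<Rightarrow> 'a word" where
  "plus_word v w = Word (letters v @ letters w)"

instance
  by standard (simp_all add: zero_word_def plus_word_def)

end

lemma letters_zero [simp]: "letters 0 = []"
  by (simp add: zero_word_def)

lemma letters_plus [simp]: "letters (v + w) = letters v @ letters w"
  by (simp add: plus_word_def)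

definition free_algebra :: "'a set \<Rightarrow> ('a word \<Rightarrow>\<^sub>0 'k::field) ring" where
  "free_algebra V =
    \<lparr>carrier = {f. \<forall>w\<in>Poly_Mapping.keys f. set (letters w) \<subseteq> V},
     mult = (*), one = 1, zero = 0, add = (+)\<rparr>"

definition free_const :: "'k::field \<Rightarrow> 'a word \<Rightarrow>\<^sub>0 'k" where
  "free_const c = Poly_Mapping.single 0 c"

definition free_var :: "'a \<Rightarrow> 'a word \<Rightarrow>\<^sub>0 'k::field" where
  "free_var a = Poly_Mapping.single (Word [a]) 1"

lemma ring_free_algebra: "ring (free_algebra V :: ('a word \<Rightarrow>\<^sub>0 'b::field) ring)"
proof (rule ringI)
  show "abelian_group (free_algebra V :: ('a word \<Rightarrow>\<^sub>0 'b) ring)"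
  proof (rule abelian_groupI)
    fix f :: "'a word \<Rightarrow>\<^sub>0 'b"
    assume "f \<in> carrier (free_algebra V)"
    then show "\<exists>g\<in>carrier (free_algebra V). g \<oplus>\<^bsub>free_algebra V\<^esub> f = \<zero>\<^bsub>free_algebra V\<^esub>"
      by (intro bexI[of _ "- f"]) (auto simp: free_algebra_def)
  next
    fix f g :: "'a word \<Rightarrow>\<^sub>0 'b"
    assume "f \<in> carrier (free_algebra V)" "g \<in> carrier (free_algebra V)"
    then show "f \<oplus>\<^bsub>free_algebra V\<^esub> g \<in> carrier (free_algebra V)"
      using Poly_Mapping.keys_add[of f g] by (auto simp: free_algebra_def)
  qed (simp_all add: free_algebra_def add_ac)
  show "Group.monoid (free_algebra V :: ('a word \<Rightarrow>\<^sub>0 'b) ring)"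
  proof (rule Group.monoidI)
    fix f g :: "'a word \<Rightarrow>\<^sub>0 'b"
    assume f: "f \<in> carrier (free_algebra V)" and g: "g \<in> carrier (free_algebra V)"
    have "set (letters w) \<subseteq> V" if "w \<in> Poly_Mapping.keys (f * g)" for w
    proof -
      from that keys_mult[of f g] obtain u v
        where "w = u + v" "u \<in> Poly_Mapping.keys f" "v \<in> Poly_Mapping.keys g" by blast
      with f g show ?thesis
        by (auto simp: free_algebra_def)
    qed
    then show "f \<otimes>\<^bsub>free_algebra V\<^esub> g \<in> carrier (free_algebra V)"
      by (simp add: free_algebra_def)
  qed (auto simp: free_algebra_def mult.assoc)
qed (auto simp: free_algebra_def algebra_simps)

definition poly_algebra :: "'v set \<Rightarrow> (('v \<Rightarrow>\<^sub>0 nat) \<Rightarrow>\<^sub>0 'k::field) ring" where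
  "poly_algebra V =
    \<lparr>carrier = {f. \<forall>m\<in>Poly_Mapping.keys f. Poly_Mapping.keys m \<subseteq> V},
     mult = (*), one = 1, zero = 0, add = (+)\<rparr>"

lemma cring_poly_algebra: "cring (poly_algebra V :: (('a \<Rightarrow>\<^sub>0 nat) \<Rightarrow>\<^sub>0 'b::field) ring)"
proof (rule cringI)
  show "abelian_group (poly_algebra V :: (('a \<Rightarrow>\<^sub>0 nat) \<Rightarrow>\<^sub>0 'b) ring)"
  proof (rule abelian_groupI)
    fix f :: "('a \<Rightarrow>\<^sub>0 nat) \<Rightarrow>\<^sub>0 'b"
    assume "f \<in> carrier (poly_algebra V)"
    then show "\<exists>g\<in>carrier (poly_algebra V). g \<oplus>\<^bsub>poly_algebra V\<^esub> f = \<zero>\<^bsub>poly_algebra V\<^esub>"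
      by (intro bexI[of _ "- f"]) (auto simp: poly_algebra_def)
  next
    fix f g :: "('a \<Rightarrow>\<^sub>0 nat) \<Rightarrow>\<^sub>0 'b"
    assume "f \<in> carrier (poly_algebra V)" "g \<in> carrier (poly_algebra V)"
    then show "f \<oplus>\<^bsub>poly_algebra V\<^esub> g \<in> carrier (poly_algebra V)"
      using Poly_Mapping.keys_add[of f g] by (auto simp: poly_algebra_def)
  qed (simp_all add: poly_algebra_def add_ac)
  show "Group.comm_monoid (poly_algebra V :: (('a \<Rightarrow>\<^sub>0 nat) \<Rightarrow>\<^sub>0 'b) ring)"
  proof (rule Group.comm_monoidI)
    fix f g :: "('a \<Rightarrow>\<^sub>0 nat) \<Rightarrow>\<^sub>0 'b"
    assume f: "f \<in> carrier (poly_algebra V)" and g: "g \<in> carrier (poly_algebra V)"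
    have "Poly_Mapping.keys m \<subseteq> V" if "m \<in> Poly_Mapping.keys (f * g)" for m
    proof -
      from that keys_mult[of f g] obtain a b
        where "m = a + b" "a \<in> Poly_Mapping.keys f" "b \<in> Poly_Mapping.keys g" by blast
      with f g Poly_Mapping.keys_add[of a b] show ?thesis
        by (simp add: poly_algebra_def) blast
    qed
    then show "f \<otimes>\<^bsub>poly_algebra V\<^esub> g \<in> carrier (poly_algebra V)"
      by (simp add: poly_algebra_def)
  qed (auto simp: poly_algebra_def mult_ac)
qed (auto simp: poly_algebra_def algebra_simps)

text \<open>\<open>X i\<close> and \<open>Y i\<close> stand for the indeterminates \<open>x\<^sup>(\<^sup>i\<^sup>)\<close> and \<open>y\<^sup>(\<^sup>i\<^sup>)\<close>.\<close>

datatype indet = X nat | Y nat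

definition B_alg :: "nat \<Rightarrow> (indet word \<Rightarrow>\<^sub>0 'k::field) ring" where
  "B_alg n = free_algebra (X ` {..n} \<union> Y ` {..n})"

definition q_relations :: "'k::field \<Rightarrow> nat \<Rightarrow> (indet word \<Rightarrow>\<^sub>0 'k) set" where
  "q_relations q n =
    {free_var (X i) * free_var (X j) - free_var (X j) * free_var (X i) | i j. i \<le> n \<and> j \<le> n} \<union>
    {free_var (Y i) * free_var (Y j) - free_var (Y j) * free_var (Y i) | i j. i \<le> n \<and> j \<le> n} \<union>
    {free_var (Y i) * free_var (X j) - free_const q * (free_var (X j) * free_var (Y i)) | i j.
       i \<le> n \<and> j \<le> n}"

definition q_ideal :: "'k::field \<Rightarrow> nat \<Rightarrow> (indet word \<Rightarrow>\<^sub>0 'k) set" where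
  "q_ideal q n = Idl\<^bsub>B_alg n\<^esub> (q_relations q n)"

definition A_alg :: "'k::field \<Rightarrow> nat \<Rightarrow> (indet word \<Rightarrow>\<^sub>0 'k) set ring" where
  "A_alg q n = B_alg n Quot q_ideal q n"

definition A_class :: "'k::field \<Rightarrow> nat \<Rightarrow> (indet word \<Rightarrow>\<^sub>0 'k) \<Rightarrow> (indet word \<Rightarrow>\<^sub>0 'k) set" where
  "A_class q n f = q_ideal q n +>\<^bsub>B_alg n\<^esub> f"

definition x_elem :: "'k::field \<Rightarrow> nat \<Rightarrow> nat \<Rightarrow> (indet word \<Rightarrow>\<^sub>0 'k) set" where
  "x_elem q n i = A_class q n (free_var (X i))"

text \<open>
  The polynomial ring in \<open>y, y', \<dots>, y\<^sup>(\<^sup>n\<^sup>)\<close>; the variable with index \<open>i\<close> is \<open>y\<^sup>(\<^sup>i\<^sup>)\<close>.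
  A polynomial defines an element of \<^const>\<open>A_alg\<close>: the monomial with exponents
  \<open>e\<^sub>0, \<dots>, e\<^sub>n\<close> is sent to the class of the word
  \<open>y\<close> (\<open>e\<^sub>0\<close> times), \<open>y'\<close> (\<open>e\<^sub>1\<close> times), \<open>\<dots>\<close>, \<open>y\<^sup>(\<^sup>n\<^sup>)\<close> (\<open>e\<^sub>n\<close> times).
  The order of the letters is immaterial, as the \<open>y\<^sup>(\<^sup>i\<^sup>)\<close> commute in the quotient.
\<close>

definition y_poly_ring :: "nat \<Rightarrow> ((nat \<Rightarrow>\<^sub>0 nat) \<Rightarrow>\<^sub>0 'k::field) ring" where
  "y_poly_ring n = poly_algebra {..n}"

definition y_word :: "nat \<Rightarrow> (nat \<Rightarrow>\<^sub>0 nat) \<Rightarrow> indet word" where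
  "y_word n m = Word (concat (map (\<lambda>i. replicate (Poly_Mapping.lookup m i) (Y i)) [0..<Suc n]))"

definition y_elem ::
  "'k::field \<Rightarrow> nat \<Rightarrow> ((nat \<Rightarrow>\<^sub>0 nat) \<Rightarrow>\<^sub>0 'k) \<Rightarrow> (indet word \<Rightarrow>\<^sub>0 'k) set" where
  "y_elem q n \<phi> = A_class q n
    (\<Sum>m\<in>Poly_Mapping.keys \<phi>. Poly_Mapping.single (y_word n m) (Poly_Mapping.lookup \<phi> m))"

lemma q_relations_subset: "q_relations q n \<subseteq> carrier (B_alg n)"
proof -
  interpret R: ring "B_alg n :: (indet word \<Rightarrow>\<^sub>0 'a) ring"
    unfolding B_alg_def by (rule ring_free_algebra)
  let ?C = "carrier (B_alg n :: (indet word \<Rightarrow>\<^sub>0 'a) ring)"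
  have mult: "f * g \<in> ?C" if "f \<in> ?C" "g \<in> ?C" for f g
    using R.m_closed[OF that] by (simp add: B_alg_def free_algebra_def)
  have minus: "f - g \<in> ?C" if "f \<in> ?C" "g \<in> ?C" for f g
    using that keys_diff[of f g] by (simp add: B_alg_def free_algebra_def) blast
  have "free_const c \<in> ?C" for c
    by (simp add: free_const_def B_alg_def free_algebra_def)
  moreover have "free_var (X i) \<in> ?C" "free_var (Y i) \<in> ?C" if "i \<le> n" for i
    using that by (auto simp: free_var_def B_alg_def free_algebra_def)
  ultimately show ?thesis
    unfolding q_relations_def by (auto intro!: mult minus)
qed

lemma ring_A_alg: "ring (A_alg q n)"
proof -
  interpret R: ring "B_alg n :: (indet word \<Rightarrow>\<^sub>0 'a) ring"
    unfolding B_alg_def by (rule ring_free_algebra)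
  interpret ideal "q_ideal q n" "B_alg n"
    unfolding q_ideal_def by (rule R.genideal_ideal[OF q_relations_subset])
  show ?thesis
    unfolding A_alg_def by (rule quotient_is_ring)
qed

text \<open>
  The elementwise condition (not the one on products of ideals). The locale
  \<^locale>\<open>primeideal\<close> cannot be used for it, since it demands a commutative ring.
\<close>

definition nc_prime_ideal :: "('a, 'b) ring_scheme \<Rightarrow> 'a set \<Rightarrow> bool" where
  "nc_prime_ideal R P \<longleftrightarrow>
    ideal P R \<and> P \<noteq> carrier R \<and>
    (\<forall>a\<in>carrier R. \<forall>b\<in>carrier R. a \<otimes>\<^bsub>R\<^esub> b \<in> P \<longrightarrow> a \<in> P \<or> b \<in> P)"

end

theory Submission
  imports Defs "HOL-Algebra.Ring_Divisibility" "HOL-Library.Multiset"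
begin

text \<open>
  Modulo the \<open>x\<^sup>(\<^sup>i\<^sup>)\<close> only the commuting variables \<open>y\<^sup>(\<^sup>i\<^sup>)\<close> survive, so the quotient of
  \<^const>\<open>A_alg\<close> by \<open>\<langle>x, \<dots>, x\<^sup>(\<^sup>n\<^sup>)\<rangle>\<close> is an image of the commutative ring
  \<open>R = k[y, \<dots>, y\<^sup>(\<^sup>n\<^sup>)]\<close>, and the ideals of \<^const>\<open>A_alg\<close> that contain all \<open>x\<^sup>(\<^sup>i\<^sup>)\<close> come from ideals
  of \<open>R\<close>. The proof makes this precise without forming the second quotient.

  The map \<^const>\<open>y_elem\<close> is a ring homomorphism \<open>R \<rightarrow> A\<close> (\<open>y_elem_ring_hom\<close>). Hence the
  polynomials sent into the prime ideal \<open>P\<close> form a prime ideal \<open>J\<close> of \<open>R\<close>, and by the Hilbert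
  basis theorem (\<open>noetherian_poly_algebra\<close>) finitely many polynomials generate it. Let \<open>I\<close> be the
  ideal of \<open>A\<close> generated by their images and the \<open>x\<^sup>(\<^sup>i\<^sup>)\<close>, so that \<open>I \<subseteq> P\<close>. Every element of \<open>A\<close>
  is congruent modulo the \<open>x\<^sup>(\<^sup>i\<^sup>)\<close> to the image of a polynomial (\<open>y_lift_surj_mod_x\<close>); therefore an
  ideal containing the \<open>x\<^sup>(\<^sup>i\<^sup>)\<close> is determined by the polynomials sent into it
  (\<open>ideal_determined_by_y_elem\<close>). For \<open>P\<close> these are the elements of \<open>J\<close>, which \<open>I\<close> receives too,
  and so \<open>I = P\<close>.

  The basis theorem is proved by leading monomials: Dickson's lemma provides finitely many members
  of an ideal whose leading monomials divide all others, and division with remainder, which ends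
  because the lexicographic order on monomials in finitely many variables is well-founded, shows
  that they generate.
\<close>

section \<open>Polynomials as sums of monomials\<close>

text \<open>
  Reduces an additive claim to monomials. The monomials are restricted to those of the given
  \<open>f\<close>, so that what is known about the support of \<open>f\<close> can be used for them.
\<close>

lemma poly_mapping_monomial_induct [case_names zero single add]:
  fixes f :: "'a \<Rightarrow>\<^sub>0 'b::comm_monoid_add"
  assumes zero: "P 0"
    and single: "\<And>k c. k \<in> Poly_Mapping.keys f \<Longrightarrow> P (Poly_Mapping.single k c)"
    and add: "\<And>g h. P g \<Longrightarrow> P h \<Longrightarrow> P (g + h)"
  shows "P f"
proof -
  have "P (\<Sum>k\<in>A. Poly_Mapping.single k (Poly_Mapping.lookup f k))"
    if "A \<subseteq> Poly_Mapping.keys f" for A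
    using finite_subset[OF that finite_keys] that
    by (induction rule: finite_induct) (auto intro: assms)
  moreover have "(\<Sum>k\<in>Poly_Mapping.keys f. Poly_Mapping.single k (Poly_Mapping.lookup f k)) = f"
    by (rule poly_mapping_eqI)
      (auto simp: lookup_sum lookup_single when_def in_keys_iff if_distrib cong: if_cong)
  ultimately show ?thesis
    by (metis order_refl)
qed

lemma lookup_monomial_mult:
  fixes g :: "'a::cancel_comm_monoid_add \<Rightarrow>\<^sub>0 'b::comm_semiring_0"
  shows "Poly_Mapping.lookup (Poly_Mapping.single u c * g) (u + k) = c * Poly_Mapping.lookup g k"
  by (induction g rule: poly_mapping_monomial_induct)
    (auto simp: mult_single lookup_single when_def lookup_add distrib_left)

section \<open>The basis theorem\<close>

text \<open>
  Dickson's lemma, with \<open>e s\<close> the exponent vector of \<open>s\<close>, so that it can select polynomials by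
  their leading monomials. For the induction on the set of variables, a finite \<open>T\<close> that works
  for \<open>V\<close> also works for a further variable \<open>w\<close> on all \<open>s\<close> whose \<open>w\<close>-exponent is at least
  every one occurring in \<open>T\<close>. The remaining \<open>s\<close> fall into finitely many classes of constant
  \<open>w\<close>-exponent, in each of which \<open>w\<close> can be ignored.
\<close>

lemma dickson:
  fixes e :: "'a \<Rightarrow> 'v \<Rightarrow> nat"
  assumes "finite V"
  shows "\<exists>T\<subseteq>S. finite T \<and> (\<forall>s\<in>S. \<exists>t\<in>T. \<forall>v\<in>V. e t v \<le> e s v)"
  using assms
proof (induction V arbitrary: S rule: finite_induct)
  case empty
  show ?case
  proof (cases "S = {}")
    case False
    then obtain s where "s \<in> S" by blast
    then show ?thesis by (intro exI[of _ "{s}"]) auto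
  qed auto
next
  case (insert w V)
  from insert.IH[of S] obtain T where T: "T \<subseteq> S" "finite T"
      "\<forall>s\<in>S. \<exists>t\<in>T. \<forall>v\<in>V. e t v \<le> e s v"
    by blast
  \<comment> \<open>The sum is a bound for the exponents also when \<open>T\<close> is empty, where a maximum is undefined.\<close>
  define N where "N = (\<Sum>t\<in>T. e t w)"
  have N: "e t w \<le> N" if "t \<in> T" for t
    unfolding N_def using T(2) that by (intro member_le_sum) auto
  have "\<forall>c. \<exists>T'. T' \<subseteq> {s \<in> S. e s w = c} \<and> finite T' \<and>
      (\<forall>s\<in>{s \<in> S. e s w = c}. \<exists>t\<in>T'. \<forall>v\<in>V. e t v \<le> e s v)"
    using insert.IH by blast
  from choice[OF this] obtain T' where "\<forall>c. T' c \<subseteq> {s \<in> S. e s w = c} \<and> finite (T' c) \<and>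
      (\<forall>s\<in>{s \<in> S. e s w = c}. \<exists>t\<in>T' c. \<forall>v\<in>V. e t v \<le> e s v)"
    by blast
  then have T': "\<And>c. T' c \<subseteq> {s \<in> S. e s w = c}" "\<And>c. finite (T' c)"
      "\<And>c s. s \<in> S \<Longrightarrow> e s w = c \<Longrightarrow> \<exists>t\<in>T' c. \<forall>v\<in>V. e t v \<le> e s v"
    by auto
  let ?U = "T \<union> (\<Union>c<N. T' c)"
  have "\<exists>t\<in>?U. \<forall>v\<in>insert w V. e t v \<le> e s v" if s: "s \<in> S" for s
  proof (cases "e s w < N")
    case True
    obtain t where t: "t \<in> T' (e s w)" "\<forall>v\<in>V. e t v \<le> e s v"
      using T'(3)[OF s refl] by blast
    then have "e t w = e s w" using T'(1) by blast
    with t True show ?thesis by (intro bexI[of _ t]) auto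
  next
    case False
    obtain t where t: "t \<in> T" "\<forall>v\<in>V. e t v \<le> e s v"
      using T(3) s by blast
    with N[of t] False show ?thesis by (intro bexI[of _ t]) auto
  qed
  moreover have "?U \<subseteq> S" "finite ?U"
    using T(1,2) T'(1,2) by blast+
  ultimately show ?case by blast
qed

text \<open>
  The order on \<^typ>\<open>'v \<Rightarrow>\<^sub>0 nat\<close> is lexicographic with the least variable most significant. With
  infinitely many variables it can descend forever, as in \<open>v\<^sub>1 > v\<^sub>2 > \<dots>\<close>; with support in a
  finite \<open>V\<close> it is the lexicographic order on exponent lists of fixed length. Bounding the
  support of the larger monomial is enough: at the first difference it has a positive exponent.
\<close>

lemma wf_monomial_less:
  fixes V :: "'v::linorder set"
  assumes V: "finite V"
  shows "wf {(a, b :: 'v \<Rightarrow>\<^sub>0 nat). Poly_Mapping.keys b \<subseteq> V \<and> a < b}"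
proof (rule wf_subset)
  let ?vs = "sorted_list_of_set V"
  let ?f = "\<lambda>m :: 'v \<Rightarrow>\<^sub>0 nat. map (Poly_Mapping.lookup m) ?vs"
  show "wf (inv_image (lex less_than) ?f)"
    by (intro wf_inv_image wf_lex wf_less_than)
  have "(?f a, ?f b) \<in> lex less_than" if b: "Poly_Mapping.keys b \<subseteq> V" and "a < b" for a b
  proof -
    from \<open>a < b\<close> obtain k where k: "Poly_Mapping.lookup a k < Poly_Mapping.lookup b k"
        "\<And>k'. k' < k \<Longrightarrow> Poly_Mapping.lookup a k' = Poly_Mapping.lookup b k'"
      unfolding less_poly_mapping.rep_eq less_fun_def by blast
    then have "k \<in> V" using b by (auto simp: in_keys_iff)
    then obtain us ws where vs: "?vs = us @ k # ws"
      using split_list[of k ?vs] V by auto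
    have "sorted_wrt (<) (us @ k # ws)"
      unfolding vs[symmetric] by simp
    then have "map (Poly_Mapping.lookup a) us = map (Poly_Mapping.lookup b) us"
      using k(2) by (simp add: sorted_wrt_append)
    then show ?thesis
      unfolding lex_conv vs using k(1)
      by (auto intro!: exI[of _ "map (Poly_Mapping.lookup b) us"])
  qed
  then show "{(a, b). Poly_Mapping.keys b \<subseteq> V \<and> a < b} \<subseteq> inv_image (lex less_than) ?f"
    by auto
qed

definition lead_monomial :: "(('v::linorder \<Rightarrow>\<^sub>0 nat) \<Rightarrow>\<^sub>0 'k::zero) \<Rightarrow> 'v \<Rightarrow>\<^sub>0 nat" where
  "lead_monomial f = Max (Poly_Mapping.keys f)"

lemma lead_monomial_in_keys: "f \<noteq> 0 \<Longrightarrow> lead_monomial f \<in> Poly_Mapping.keys f"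
  unfolding lead_monomial_def by (intro Max_in) auto

lemma lead_monomial_ge: "k \<in> Poly_Mapping.keys f \<Longrightarrow> k \<le> lead_monomial f"
  unfolding lead_monomial_def by simp

text \<open>
  One step of division with remainder: \<open>u\<close> is the quotient of the leading monomials, and \<open>c\<close>
  that of the leading coefficients.
\<close>

lemma lead_monomial_cancel:
  fixes f g :: "('v::linorder \<Rightarrow>\<^sub>0 nat) \<Rightarrow>\<^sub>0 'k::field"
  assumes "f \<noteq> 0" "g \<noteq> 0" and lead: "lead_monomial f = u + lead_monomial g"
  obtains c where
    "f - Poly_Mapping.single u c * g = 0 \<or>
     lead_monomial (f - Poly_Mapping.single u c * g) < lead_monomial f"
proof
  let ?c = "Poly_Mapping.lookup f (lead_monomial f) / Poly_Mapping.lookup g (lead_monomial g)"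
  let ?r = "f - Poly_Mapping.single u ?c * g"
  have "Poly_Mapping.lookup g (lead_monomial g) \<noteq> 0"
    using lead_monomial_in_keys[OF \<open>g \<noteq> 0\<close>] by (simp add: in_keys_iff)
  then have cancel: "Poly_Mapping.lookup ?r (lead_monomial f) = 0"
    using lookup_monomial_mult[of u ?c g "lead_monomial g"]
    by (simp add: lookup_minus lead)
  have le: "k \<le> lead_monomial f" if "k \<in> Poly_Mapping.keys ?r" for k
  proof -
    from that have "k \<in> Poly_Mapping.keys f \<or> k \<in> Poly_Mapping.keys (Poly_Mapping.single u ?c * g)"
      using subsetD[OF keys_diff that] by simp
    then show ?thesis
    proof
      assume "k \<in> Poly_Mapping.keys (Poly_Mapping.single u ?c * g)"
      then obtain j where "k = u + j" "j \<in> Poly_Mapping.keys g"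
        using subsetD[OF keys_mult] by (force split: if_splits)
      then show ?thesis
        unfolding lead by (simp add: add_left_mono lead_monomial_ge)
    qed (rule lead_monomial_ge)
  qed
  show "?r = 0 \<or> lead_monomial ?r < lead_monomial f"
  proof (cases "?r = 0")
    case False
    then have r: "lead_monomial ?r \<in> Poly_Mapping.keys ?r"
      by (rule lead_monomial_in_keys)
    have "lead_monomial ?r \<noteq> lead_monomial f"
      using r cancel by (metis in_keys_iff)
    with le[OF r] show ?thesis
      by (intro disjI2 order_le_neq_trans)
  qed (rule disjI1)
qed

lemma poly_algebra_simps:
  "monoid.mult (poly_algebra V) = (*)" "one (poly_algebra V) = 1"
  "zero (poly_algebra V) = 0" "add (poly_algebra V) = (+)"
  "f \<in> carrier (poly_algebra V) \<longleftrightarrow> (\<forall>m\<in>Poly_Mapping.keys f. Poly_Mapping.keys m \<subseteq> V)"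
  by (simp_all add: poly_algebra_def)

lemma ideal_poly_algebra_diff:
  fixes f g :: "('v \<Rightarrow>\<^sub>0 nat) \<Rightarrow>\<^sub>0 'k::field"
  assumes "ideal J (poly_algebra V)" "f \<in> J" "g \<in> J" "h \<in> carrier (poly_algebra V)"
  shows "f - h * g \<in> J"
proof -
  interpret ideal J "poly_algebra V" by fact
  have "- h \<in> carrier (poly_algebra V)"
    using assms(4) by (simp add: poly_algebra_simps)
  from additive_subgroup.a_closed[OF is_additive_subgroup \<open>f \<in> J\<close> I_l_closed[OF \<open>g \<in> J\<close> this]]
  show ?thesis
    by (simp add: poly_algebra_simps)
qed

text \<open>
  Hilbert's basis theorem. The generators found form a Groebner basis: the leading monomial of
  every nonzero member of the ideal is divisible by that of a generator.
\<close>

theorem noetherian_poly_algebra: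
  fixes V :: "'v::linorder set"
  assumes V: "finite V"
  shows "noetherian_ring (poly_algebra V :: (('v \<Rightarrow>\<^sub>0 nat) \<Rightarrow>\<^sub>0 'k::field) ring)"
proof -
  let ?R = "poly_algebra V :: (('v \<Rightarrow>\<^sub>0 nat) \<Rightarrow>\<^sub>0 'k) ring"
  interpret R: cring ?R by (rule cring_poly_algebra)
  have "\<exists>G\<subseteq>carrier ?R. finite G \<and> J = Idl\<^bsub>?R\<^esub> G" if J: "ideal J ?R" for J
  proof -
    interpret J: ideal J ?R by (rule J)
    obtain G where G: "G \<subseteq> J - {0}" "finite G" "\<forall>f\<in>J - {0}. \<exists>g\<in>G. \<forall>v\<in>V.
        Poly_Mapping.lookup (lead_monomial g) v \<le> Poly_Mapping.lookup (lead_monomial f) v"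
      using dickson[OF V, of "J - {0}" "\<lambda>f. Poly_Mapping.lookup (lead_monomial f)"] by blast
    have GJ: "G \<subseteq> J" and GR: "G \<subseteq> carrier ?R"
      using G(1) J.a_subset by auto
    let ?I = "Idl\<^bsub>?R\<^esub> G"
    interpret I: ideal ?I ?R by (rule R.genideal_ideal[OF GR])
    have zero: "0 \<in> ?I"
      using I.zero_closed by (simp add: poly_algebra_simps)
    \<comment> \<open>Dividing by a suitable \<open>g \<in> G\<close> leaves a remainder in \<open>J\<close> with a smaller leading monomial.\<close>
    have "f \<in> ?I" if "f \<in> J" for f
      using wf_inv_image[OF wf_monomial_less[OF V], of lead_monomial] that
    proof (induction f rule: wf_induct_rule)
      case (less f)
      show ?case
      proof (cases "f = 0")
        case False
        with less.prems G(3) obtain g where g: "g \<in> G" and le: "\<forall>v\<in>V.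
            Poly_Mapping.lookup (lead_monomial g) v \<le> Poly_Mapping.lookup (lead_monomial f) v"
          by blast
        have g0: "g \<noteq> 0" and gJ: "g \<in> J" and gR: "g \<in> carrier ?R"
          using g G(1) GR by auto
        have fR: "f \<in> carrier ?R"
          using less.prems J.a_subset by auto
        have keys_f: "Poly_Mapping.keys (lead_monomial f) \<subseteq> V"
          using fR lead_monomial_in_keys[OF False] by (simp add: poly_algebra_simps)
        have keys_g: "Poly_Mapping.keys (lead_monomial g) \<subseteq> V"
          using gR lead_monomial_in_keys[OF g0] by (simp add: poly_algebra_simps)
        define u where "u = lead_monomial f - lead_monomial g"
        have u: "Poly_Mapping.keys u \<subseteq> V"
          using keys_f by (auto simp: u_def in_keys_iff minus_poly_mapping.rep_eq)
        have "lead_monomial f = u + lead_monomial g"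
        proof (rule poly_mapping_eqI)
          fix v
          show "Poly_Mapping.lookup (lead_monomial f) v = Poly_Mapping.lookup (u + lead_monomial g) v"
            using le keys_g not_in_keys_iff_lookup_eq_zero[of v "lead_monomial g"]
            by (cases "v \<in> V") (auto simp: u_def lookup_add minus_poly_mapping.rep_eq)
        qed
        then obtain c where c: "f - Poly_Mapping.single u c * g = 0 \<or>
            lead_monomial (f - Poly_Mapping.single u c * g) < lead_monomial f"
          using lead_monomial_cancel[OF False g0] by blast
        let ?s = "Poly_Mapping.single u c" and ?r = "f - Poly_Mapping.single u c * g"
        have s: "?s \<in> carrier ?R"
          using u by (simp add: poly_algebra_simps)
        have "?r \<in> J"
          using ideal_poly_algebra_diff[OF J less.prems gJ s] .
        with c less.IH[of ?r] keys_f zero have "?r \<in> ?I"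
          by auto
        moreover have "?s * g \<in> ?I"
          using I.I_l_closed[OF _ s, of g] R.genideal_self[OF GR] g
          by (auto simp: poly_algebra_simps)
        ultimately have "?r + ?s * g \<in> ?I"
          using additive_subgroup.a_closed[OF I.is_additive_subgroup, of ?r "?s * g"]
          by (simp add: poly_algebra_simps)
        then show ?thesis by simp
      qed (use zero in simp)
    qed
    then have "J = ?I"
      using R.genideal_minimal[OF J GJ] by blast
    with GR G(2) show ?thesis by blast
  qed
  then show ?thesis
    by (rule noetherian_ring.intro[OF R.ring_axioms noetherian_ring_axioms.intro])
qed

section \<open>Words in the free algebra modulo the relations\<close>

lemma B_alg_simps:
  "monoid.mult (B_alg n) = (*)" "one (B_alg n) = 1" "zero (B_alg n) = 0" "add (B_alg n) = (+)"
  "f \<in> carrier (B_alg n) \<longleftrightarrow>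
    (\<forall>w\<in>Poly_Mapping.keys f. set (letters w) \<subseteq> X ` {..n} \<union> Y ` {..n})"
  by (simp_all add: B_alg_def free_algebra_def)

lemma ring_B_alg: "ring (B_alg n)"
  unfolding B_alg_def by (rule ring_free_algebra)

lemma single_in_B_alg:
  "set w \<subseteq> X ` {..n} \<union> Y ` {..n} \<Longrightarrow> Poly_Mapping.single (Word w) c \<in> carrier (B_alg n)"
  by (simp add: B_alg_simps)

lemma ideal_B_alg_closed:
  fixes L :: "(indet word \<Rightarrow>\<^sub>0 'k::field) set"
  assumes "ideal L (B_alg n)"
  shows "0 \<in> L"
    and "f \<in> L \<Longrightarrow> g \<in> L \<Longrightarrow> f + g \<in> L"
    and "f \<in> L \<Longrightarrow> g \<in> L \<Longrightarrow> f - g \<in> L"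
    and "f \<in> L \<Longrightarrow> h \<in> carrier (B_alg n) \<Longrightarrow> h * f \<in> L"
    and "f \<in> L \<Longrightarrow> h \<in> carrier (B_alg n) \<Longrightarrow> f * h \<in> L"
proof -
  interpret ideal L "B_alg n" by fact
  show "0 \<in> L"
    using additive_subgroup.zero_closed[OF is_additive_subgroup] by (simp add: B_alg_simps(3))
  have add: "f + g \<in> L" if "f \<in> L" "g \<in> L" for f g
    using additive_subgroup.a_closed[OF is_additive_subgroup that] by (simp add: B_alg_simps(4))
  have mult: "h * f \<in> L" if "f \<in> L" "h \<in> carrier (B_alg n)" for f h
    using I_l_closed[OF that] by (simp add: B_alg_simps(1))
  show "f * h \<in> L" if "f \<in> L" "h \<in> carrier (B_alg n)"
    using I_r_closed[OF that] by (simp add: B_alg_simps(1))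
  show "f - g \<in> L" if "f \<in> L" "g \<in> L"
    using add[OF that(1) mult[OF that(2), of "- 1"]] by (simp add: B_alg_simps)
  show "f \<in> L \<Longrightarrow> g \<in> L \<Longrightarrow> f + g \<in> L" by (rule add)
  show "f \<in> L \<Longrightarrow> h \<in> carrier (B_alg n) \<Longrightarrow> h * f \<in> L" by (rule mult)
qed

lemma Word_append: "Word (u @ v) = Word u + Word v"
  by (simp add: plus_word_def)

text \<open>
  In \<^const>\<open>A_alg\<close> the order of the letters in a word of \<open>y\<^sup>(\<^sup>i\<^sup>)\<close> is immaterial. The relations
  exchange two adjacent letters; from this the first letter of \<open>u\<close> is moved to its place in
  \<open>v\<close>, and induction on \<open>u\<close> arranges the rest. The ideal \<open>L\<close> is arbitrary, because the result
  is needed both for the defining ideal and for larger ones that contain the \<open>x\<^sup>(\<^sup>i\<^sup>)\<close>.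
\<close>

lemma y_words_permute:
  fixes L :: "(indet word \<Rightarrow>\<^sub>0 'k::field) set"
  assumes L: "ideal L (B_alg n)" and rel: "q_relations q n \<subseteq> L"
    and perm: "mset u = mset v" and u: "set u \<subseteq> Y ` {..n}"
  shows "Poly_Mapping.single (Word u) c - Poly_Mapping.single (Word v) c \<in> L"
proof -
  define eqv where "eqv a b \<longleftrightarrow>
    Poly_Mapping.single (Word a) (1::'k) - Poly_Mapping.single (Word b) 1 \<in> L" for a b
  note closed = ideal_B_alg_closed[OF L]
  have trans: "eqv a c" if "eqv a b" "eqv b c" for a b c
    using closed(2)[OF that[unfolded eqv_def]] by (simp add: eqv_def)
  have y_word: "Poly_Mapping.single (Word a) c \<in> carrier (B_alg n)" if "set a \<subseteq> Y ` {..n}"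
    for a and c :: 'k
    using that by (intro single_in_B_alg) auto
  have prefix: "eqv (a @ b) (a @ c)" if "eqv b c" "set a \<subseteq> Y ` {..n}" for a b c
    using closed(4)[OF that(1)[unfolded eqv_def], of "Poly_Mapping.single (Word a) 1"] that(2)
    by (simp add: eqv_def y_word Word_append mult_single right_diff_distrib)
  have suffix: "eqv (b @ a) (c @ a)" if "eqv b c" "set a \<subseteq> Y ` {..n}" for a b c
    using closed(5)[OF that(1)[unfolded eqv_def], of "Poly_Mapping.single (Word a) 1"] that(2)
    by (simp add: eqv_def y_word Word_append mult_single left_diff_distrib)
  have swap: "eqv [a, b] [b, a]" if ab: "a \<in> Y ` {..n}" "b \<in> Y ` {..n}" for a b
  proof -
    have "free_var a * free_var b - free_var b * free_var a \<in> q_relations q n"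
      using ab unfolding q_relations_def by blast
    with rel show ?thesis
      by (auto simp: eqv_def free_var_def mult_single plus_word_def)
  qed
  have move: "eqv (a # b) (b @ [a])" if "a \<in> Y ` {..n}" "set b \<subseteq> Y ` {..n}" for a b
    using that(2)
  proof (induction b)
    case Nil
    show ?case using closed(1) by (simp add: eqv_def)
  next
    case (Cons x b)
    have "eqv (a # x # b) (x # a # b)"
      using suffix[OF swap[of a x], of b] that(1) Cons.prems by simp
    moreover have "eqv (x # a # b) (x # b @ [a])"
      using prefix[of "a # b" "b @ [a]" "[x]"] Cons by simp
    ultimately show ?case
      by (auto intro: trans)
  qed
  have "eqv u v"
    using perm u
  proof (induction u arbitrary: v)
    case Nil
    then show ?case using closed(1) by (simp add: eqv_def)
  next
    case (Cons a u)
    from Cons.prems(1) have "a \<in> set v"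
      by (metis list.set_intros(1) mset_eq_setD)
    then obtain v1 v2 where v: "v = v1 @ a # v2"
      by (meson split_list)
    have "set v = set (a # u)"
      using Cons.prems(1) by (metis mset_eq_setD)
    then have sets: "set v1 \<subseteq> Y ` {..n}" "set v2 \<subseteq> Y ` {..n}" "a \<in> Y ` {..n}"
      using Cons.prems(2) v by auto
    have "eqv u (v1 @ v2)"
      using Cons v by simp
    then have "eqv (a # u) (a # v1 @ v2)"
      using prefix[of u "v1 @ v2" "[a]"] sets by simp
    moreover have "eqv (a # v1 @ v2) v"
      using suffix[OF move[of a v1], of v2] sets v by simp
    ultimately show ?case by (rule trans)
  qed
  from closed(4)[OF this[unfolded eqv_def], of "Poly_Mapping.single (Word []) c"]
  show ?thesis
    by (simp add: single_in_B_alg right_diff_distrib mult_single plus_word_def)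
qed

lemma mset_y_word_add:
  "mset (letters (y_word n (a + b))) = mset (letters (y_word n a)) + mset (letters (y_word n b))"
proof -
  have "mset (concat (map (\<lambda>i. replicate (Poly_Mapping.lookup (a + b) i) (Y i)) is)) =
      mset (concat (map (\<lambda>i. replicate (Poly_Mapping.lookup a i) (Y i)) is)) +
      mset (concat (map (\<lambda>i. replicate (Poly_Mapping.lookup b i) (Y i)) is))" for "is"
    by (induction "is") (simp_all add: lookup_add replicate_add)
  then show ?thesis
    by (simp add: y_word_def del: upt_Suc)
qed

lemma y_word_single:
  assumes "i \<le> n"
  shows "y_word n (Poly_Mapping.single i 1) = Word [Y i]"
proof -
  have "[0..<Suc n] = [0..<i] @ i # [Suc i..<Suc n]"
    using assms upt_add_eq_append[of 0 i "Suc n - i"] by (simp add: upt_conv_Cons del: upt_Suc)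
  moreover have
    "concat (map (\<lambda>j. replicate (Poly_Mapping.lookup (Poly_Mapping.single i (1::nat)) j) (Y j)) js)
      = []" if "i \<notin> set js" for js
    using that by (induction js) (auto simp: lookup_single when_def)
  note none = this[of "[0..<i]"] this[of "[Suc i..<Suc n]"]
  ultimately show ?thesis
    using none by (simp add: y_word_def del: upt_Suc concat_eq_Nil_conv One_nat_def) simp
qed

lemma y_word_zero: "y_word n 0 = 0"
  by (simp add: y_word_def zero_word_def)

lemma set_y_word: "set (letters (y_word n m)) \<subseteq> Y ` {..n}"
  by (auto simp: y_word_def simp del: upt_Suc)

text \<open>
  Together with \<open>y_words_permute\<close>: every word of \<open>y\<^sup>(\<^sup>i\<^sup>)\<close> is congruent to the sorted word of a
  monomial.
\<close>

lemma y_word_exhausts: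
  "set w \<subseteq> Y ` {..n} \<Longrightarrow>
    \<exists>m. Poly_Mapping.keys m \<subseteq> {..n} \<and> mset (letters (y_word n m)) = mset w"
proof (induction w)
  case Nil
  show ?case by (intro exI[of _ 0]) (simp add: y_word_zero)
next
  case (Cons a w)
  then obtain m i where m: "Poly_Mapping.keys m \<subseteq> {..n}" "mset (letters (y_word n m)) = mset w"
    and i: "a = Y i" "i \<le> n"
    by auto
  show ?case
    using keys_add[of "Poly_Mapping.single i 1" m] m i
    by (intro exI[of _ "Poly_Mapping.single i 1 + m"])
      (auto simp: mset_y_word_add y_word_single simp del: One_nat_def split: if_splits)
qed

section \<open>Lifting polynomials in \<open>y\<close> to the free algebra\<close>

text \<open>
  The representative in the free algebra from which \<^const>\<open>y_elem\<close> is formed. It is additive on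
  the nose, but multiplicative only modulo the relations.
\<close>

definition y_lift :: "nat \<Rightarrow> ((nat \<Rightarrow>\<^sub>0 nat) \<Rightarrow>\<^sub>0 'k::field) \<Rightarrow> indet word \<Rightarrow>\<^sub>0 'k" where
  "y_lift n \<phi> =
    (\<Sum>m\<in>Poly_Mapping.keys \<phi>. Poly_Mapping.single (y_word n m) (Poly_Mapping.lookup \<phi> m))"

lemma y_elem_eq: "y_elem q n \<phi> = A_class q n (y_lift n \<phi>)"
  by (simp add: y_elem_def y_lift_def)

lemma y_lift_superset:
  assumes "finite S" "Poly_Mapping.keys \<phi> \<subseteq> S"
  shows "y_lift n \<phi> = (\<Sum>m\<in>S. Poly_Mapping.single (y_word n m) (Poly_Mapping.lookup \<phi> m))"
  unfolding y_lift_def using assms by (intro sum.mono_neutral_left) (auto simp: in_keys_iff)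

lemma y_lift_add: "y_lift n (\<phi> + \<psi>) = y_lift n \<phi> + y_lift n \<psi>"
proof -
  let ?S = "Poly_Mapping.keys \<phi> \<union> Poly_Mapping.keys \<psi>"
  show ?thesis
    using keys_add[of \<phi> \<psi>]
    by (simp add: y_lift_superset[of ?S] lookup_add single_add sum.distrib)
qed

lemma y_lift_single: "y_lift n (Poly_Mapping.single m c) = Poly_Mapping.single (y_word n m) c"
  using y_lift_superset[of "{m}" "Poly_Mapping.single m c"] by simp

lemma y_lift_zero: "y_lift n 0 = 0"
  by (simp add: y_lift_def)

lemma y_lift_one: "y_lift n 1 = 1"
  using y_lift_single[of n 0 1] by (simp add: y_word_zero)

lemma y_lift_in_B_alg: "y_lift n \<phi> \<in> carrier (B_alg n)"
proof (induction \<phi> rule: poly_mapping_monomial_induct)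
  case (single k c)
  then show ?case
    using single_in_B_alg[of "letters (y_word n k)" n c] set_y_word[of n k]
    by (simp add: y_lift_single le_supI2)
next
  case (add g h)
  then show ?case
    using ring.ring_simprules(1)[OF ring_B_alg add] by (simp add: y_lift_add B_alg_simps(4))
qed (simp add: y_lift_zero B_alg_simps)

text \<open>
  By bilinearity only two monomials have to be compared, and there both sides are words with the
  same letters.
\<close>

lemma y_lift_mult:
  fixes L :: "(indet word \<Rightarrow>\<^sub>0 'k::field) set"
  assumes L: "ideal L (B_alg n)" and rel: "q_relations q n \<subseteq> L"
  shows "y_lift n (\<phi> * \<psi>) - y_lift n \<phi> * y_lift n \<psi> \<in> L"
proof (induction \<phi> rule: poly_mapping_monomial_induct)
  case zero
  show ?case using ideal_B_alg_closed(1)[OF L] by (simp add: y_lift_zero)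
next
  case (single a c)
  show ?case
  proof (induction \<psi> rule: poly_mapping_monomial_induct)
    case zero
    show ?case using ideal_B_alg_closed(1)[OF L] by (simp add: y_lift_zero)
  next
    case (single b d)
    have "Poly_Mapping.single (Word (letters (y_word n (a + b)))) (c * d) -
        Poly_Mapping.single (Word (letters (y_word n a) @ letters (y_word n b))) (c * d) \<in> L"
      by (rule y_words_permute[OF L rel]) (simp_all add: mset_y_word_add set_y_word)
    then show ?case
      by (simp add: mult_single y_lift_single Word_append)
  next
    case (add g h)
    then show ?case
      using ideal_B_alg_closed(2)[OF L add] by (simp add: y_lift_add algebra_simps)
  qed
next
  case (add g h)
  then show ?case
    using ideal_B_alg_closed(2)[OF L add] by (simp add: y_lift_add algebra_simps)
qed

text \<open>
  A word either contains some \<open>x\<^sup>(\<^sup>i\<^sup>)\<close>, and then lies in \<open>L\<close>, or consists of \<open>y\<^sup>(\<^sup>i\<^sup>)\<close> only, and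
  then is a permutation of the word of a monomial.
\<close>

lemma y_lift_surj_mod_x:
  fixes L :: "(indet word \<Rightarrow>\<^sub>0 'k::field) set"
  assumes L: "ideal L (B_alg n)" and rel: "q_relations q n \<subseteq> L"
    and x: "\<And>i. i \<le> n \<Longrightarrow> free_var (X i) \<in> L"
    and f: "f \<in> carrier (B_alg n)"
  shows "\<exists>\<phi>\<in>carrier (y_poly_ring n). f - y_lift n \<phi> \<in> L"
proof (induction f rule: poly_mapping_monomial_induct)
  case zero
  show ?case
    using ideal_B_alg_closed(1)[OF L]
    by (intro bexI[of _ 0]) (simp_all add: y_lift_zero y_poly_ring_def poly_algebra_simps)
next
  case (single k c)
  define w where "w = letters k"
  have k: "k = Word w" by (simp add: w_def)
  have w: "set w \<subseteq> X ` {..n} \<union> Y ` {..n}"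
    using f single by (simp add: B_alg_simps w_def)
  show ?case
  proof (cases "set w \<subseteq> Y ` {..n}")
    case True
    then obtain m where m: "Poly_Mapping.keys m \<subseteq> {..n}" "mset (letters (y_word n m)) = mset w"
      using y_word_exhausts by blast
    have "Poly_Mapping.single (Word w) c - y_lift n (Poly_Mapping.single m c) \<in> L"
      using y_words_permute[OF L rel, of w "letters (y_word n m)" c] m True
      by (simp add: y_lift_single)
    with m(1) show ?thesis
      by (intro bexI[of _ "Poly_Mapping.single m c"])
        (simp_all add: k y_poly_ring_def poly_algebra_simps)
  next
    case False
    then obtain a where "a \<in> set w" "a \<notin> Y ` {..n}"
      by blast
    with w obtain i where i: "X i \<in> set w" "i \<le> n"
      by auto
    then obtain u v where uv: "w = u @ X i # v"
      by (meson split_list)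
    have "Poly_Mapping.single (Word u) c * free_var (X i) * Poly_Mapping.single (Word v) 1 \<in> L"
      using w uv i
      by (intro ideal_B_alg_closed(4,5)[OF L] x single_in_B_alg) auto
    also have "Poly_Mapping.single (Word u) c * free_var (X i) * Poly_Mapping.single (Word v) 1 =
        Poly_Mapping.single k c"
      by (simp add: free_var_def mult_single plus_word_def uv k)
    finally show ?thesis
      by (intro bexI[of _ 0]) (simp_all add: y_lift_zero y_poly_ring_def poly_algebra_simps)
  qed
next
  case (add g h)
  then obtain \<phi> \<psi> where *: "\<phi> \<in> carrier (y_poly_ring n)" "\<psi> \<in> carrier (y_poly_ring n)"
      "g - y_lift n \<phi> \<in> L" "h - y_lift n \<psi> \<in> L"
    by blast
  have "\<phi> + \<psi> \<in> carrier (y_poly_ring n)"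
    using * keys_add[of \<phi> \<psi>] by (auto simp: y_poly_ring_def poly_algebra_simps)
  moreover have "g + h - y_lift n (\<phi> + \<psi>) \<in> L"
    using ideal_B_alg_closed(2)[OF L *(3,4)] by (simp add: y_lift_add algebra_simps)
  ultimately show ?case by blast
qed

section \<open>The quotient algebra\<close>

lemma ideal_q_ideal: "ideal (q_ideal q n) (B_alg n)"
  unfolding q_ideal_def by (rule ring.genideal_ideal[OF ring_B_alg q_relations_subset])

lemma q_relations_subset_q_ideal: "q_relations q n \<subseteq> q_ideal q n"
  unfolding q_ideal_def by (rule ring.genideal_self[OF ring_B_alg q_relations_subset])

lemma A_class_ring_hom: "ring_hom_ring (B_alg n) (A_alg q n) (A_class q n)"
proof -
  have "A_class q n = (+>\<^bsub>B_alg n\<^esub>) (q_ideal q n)"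
    by (rule ext) (simp add: A_class_def)
  then show ?thesis
    using ideal.rcos_ring_hom_ring[OF ideal_q_ideal[of q n]] by (simp add: A_alg_def)
qed

lemma A_class_surj:
  assumes "a \<in> carrier (A_alg q n)"
  obtains f where "f \<in> carrier (B_alg n)" "a = A_class q n f"
  using assms
  by (auto simp: A_alg_def A_class_def FactRing_def A_RCOSETS_def')

lemma A_class_eqI:
  assumes "f \<in> carrier (B_alg n)" "g \<in> carrier (B_alg n)" "f - g \<in> q_ideal q n"
  shows "A_class q n f = A_class q n g"
proof -
  interpret ideal "q_ideal q n" "B_alg n" by (rule ideal_q_ideal)
  interpret h: ring_hom_ring "B_alg n" "A_alg q n" "A_class q n" by (rule A_class_ring_hom)
  have "A_class q n (f - g) = \<zero>\<^bsub>A_alg q n\<^esub>"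
    using a_rcos_const[OF assms(3)] by (simp add: A_class_def A_alg_def FactRing_def)
  then have "A_class q n ((f - g) \<oplus>\<^bsub>B_alg n\<^esub> g) = A_class q n g"
    using h.hom_add[OF a_Hcarr[OF assms(3)] assms(2)] h.hom_closed[OF assms(2)] by simp
  then show ?thesis by (simp add: B_alg_simps)
qed

lemma y_elem_ring_hom: "ring_hom_ring (y_poly_ring n) (A_alg q n) (y_elem q n)"
proof (rule ring_hom_ringI)
  interpret h: ring_hom_ring "B_alg n" "A_alg q n" "A_class q n" by (rule A_class_ring_hom)
  show "ring (y_poly_ring n :: ((nat \<Rightarrow>\<^sub>0 nat) \<Rightarrow>\<^sub>0 'a) ring)"
    unfolding y_poly_ring_def by (rule cring.axioms(1)[OF cring_poly_algebra])
  show "ring (A_alg q n)" by (rule ring_A_alg)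
  fix \<phi> \<psi> :: "(nat \<Rightarrow>\<^sub>0 nat) \<Rightarrow>\<^sub>0 'a"
  show "y_elem q n \<phi> \<in> carrier (A_alg q n)"
    by (simp add: y_elem_eq y_lift_in_B_alg)
  show "y_elem q n (\<phi> \<oplus>\<^bsub>y_poly_ring n\<^esub> \<psi>) = y_elem q n \<phi> \<oplus>\<^bsub>A_alg q n\<^esub> y_elem q n \<psi>"
    using h.hom_add[OF y_lift_in_B_alg y_lift_in_B_alg, of \<phi> \<psi>]
    by (simp add: y_elem_eq y_poly_ring_def poly_algebra_simps B_alg_simps y_lift_add)
  have "y_lift n \<phi> * y_lift n \<psi> \<in> carrier (B_alg n)"
    using h.R.m_closed[OF y_lift_in_B_alg y_lift_in_B_alg, of \<phi> \<psi>] by (simp add: B_alg_simps(1))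
  then have "A_class q n (y_lift n (\<phi> * \<psi>)) = A_class q n (y_lift n \<phi> * y_lift n \<psi>)"
    by (intro A_class_eqI y_lift_in_B_alg y_lift_mult[OF ideal_q_ideal q_relations_subset_q_ideal])
  then show "y_elem q n (\<phi> \<otimes>\<^bsub>y_poly_ring n\<^esub> \<psi>) = y_elem q n \<phi> \<otimes>\<^bsub>A_alg q n\<^esub> y_elem q n \<psi>"
    using h.hom_mult[OF y_lift_in_B_alg y_lift_in_B_alg, of \<phi> \<psi>]
    by (simp add: y_elem_eq y_poly_ring_def poly_algebra_simps B_alg_simps)
next
  interpret h: ring_hom_ring "B_alg n" "A_alg q n" "A_class q n" by (rule A_class_ring_hom)
  show "y_elem q n \<one>\<^bsub>y_poly_ring n\<^esub> = \<one>\<^bsub>A_alg q n\<^esub>"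
    using h.hom_one by (simp add: y_elem_eq y_poly_ring_def poly_algebra_simps B_alg_simps y_lift_one)
qed

text \<open>
  For a commutative source the elementwise notion of a prime ideal is the usual one. The preimage
  is proper because homomorphisms preserve \<open>1\<close>.
\<close>

lemma nc_prime_ideal_vimage:
  assumes h: "ring_hom_ring R S h" and R: "cring R" and P: "nc_prime_ideal S P"
  shows "primeideal {r \<in> carrier R. h r \<in> P} R"
proof -
  interpret h: ring_hom_ring R S h by (rule h)
  interpret P: ideal P S using P by (simp add: nc_prime_ideal_def)
  show ?thesis
  proof (rule primeidealI[OF h.ideal_vimage[OF P.is_ideal] R])
    have "\<one>\<^bsub>S\<^esub> \<notin> P"
      using P P.one_imp_carrier by (auto simp: nc_prime_ideal_def)
    then have "\<one>\<^bsub>R\<^esub> \<notin> {r \<in> carrier R. h r \<in> P}" by simp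
    then show "carrier R \<noteq> {r \<in> carrier R. h r \<in> P}" by blast
  qed (use P in \<open>auto simp: nc_prime_ideal_def\<close>)
qed

text \<open>
  If \<open>p \<in> P\<close> is congruent to the image of \<open>\<phi>\<close> modulo \<open>I\<close>, hence modulo \<open>P\<close>, then the image of
  \<open>\<phi>\<close> lies in \<open>P\<close>, thus in \<open>I\<close>, and so does \<open>p\<close>. The congruence comes from the free algebra,
  applied to the preimages of \<open>I\<close> and \<open>P\<close> there.
\<close>

lemma ideal_determined_by_y_elem:
  assumes I: "ideal I (A_alg q n)" and P: "ideal P (A_alg q n)"
    and sub: "I \<subseteq> P" and x: "x_elem q n ` {..n} \<subseteq> I"
    and y: "\<And>\<phi>. \<phi> \<in> carrier (y_poly_ring n) \<Longrightarrow> y_elem q n \<phi> \<in> P \<Longrightarrow> y_elem q n \<phi> \<in> I"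
  shows "I = P"
proof (rule equalityI[OF sub subsetI])
  interpret h: ring_hom_ring "B_alg n" "A_alg q n" "A_class q n" by (rule A_class_ring_hom)
  interpret Q: ideal "q_ideal q n" "B_alg n" by (rule ideal_q_ideal)
  interpret I: ideal I "A_alg q n" by (rule I)
  let ?I = "{f \<in> carrier (B_alg n). A_class q n f \<in> I}"
  let ?P = "{f \<in> carrier (B_alg n). A_class q n f \<in> P}"
  note I' = h.ideal_vimage[OF I] and P' = h.ideal_vimage[OF P]
  fix p assume p: "p \<in> P"
  have "p \<in> carrier (A_alg q n)"
    using p P by (rule ideal.Icarr[rotated])
  then obtain f where f: "f \<in> carrier (B_alg n)" "p = A_class q n f"
    by (rule A_class_surj)
  have "r \<in> ?I" if "r \<in> q_relations q n" for r
  proof -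
    have r: "r \<in> q_ideal q n" using that q_relations_subset_q_ideal by blast
    then have "A_class q n r = \<zero>\<^bsub>A_alg q n\<^esub>"
      using Q.a_rcos_const[OF r] by (simp add: A_class_def A_alg_def FactRing_def)
    then show ?thesis using Q.a_Hcarr[OF r] I.zero_closed by simp
  qed
  moreover have "free_var (X i) \<in> ?I" if "i \<le> n" for i
    using that x by (auto simp: x_elem_def free_var_def single_in_B_alg)
  ultimately obtain \<phi> where \<phi>: "\<phi> \<in> carrier (y_poly_ring n)" "f - y_lift n \<phi> \<in> ?I"
    using y_lift_surj_mod_x[OF I' _ _ f(1), of q] by blast
  have "f \<in> ?P" "f - y_lift n \<phi> \<in> ?P"
    using f p \<phi>(2) sub by auto
  from ideal_B_alg_closed(3)[OF P' this] have "y_elem q n \<phi> \<in> P"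
    by (simp add: y_elem_eq)
  then have "y_lift n \<phi> \<in> ?I"
    using y[OF \<phi>(1)] by (simp add: y_elem_eq y_lift_in_B_alg)
  from ideal_B_alg_closed(2)[OF I' \<phi>(2) this] show "p \<in> I"
    using f by simp
qed

section \<open>Prime ideals containing all \<open>x\<^sup>(\<^sup>i\<^sup>)\<close>\<close>

theorem theorem4:
  fixes q :: "'k::field" and n :: nat and P :: "(indet word \<Rightarrow>\<^sub>0 'k) set set"
  assumes "q \<noteq> 0"
    and "\<forall>m::nat. m > 0 \<longrightarrow> q ^ m \<noteq> 1"
    and "nc_prime_ideal (A_alg q n) P"
    and "Idl\<^bsub>A_alg q n\<^esub> (x_elem q n ` {..n}) \<subseteq> P"
  shows "\<exists>(m::nat) \<phi>.
           \<phi> ` {1..m} \<subseteq> carrier (y_poly_ring n) \<and>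
           primeideal (Idl\<^bsub>y_poly_ring n\<^esub> (\<phi> ` {1..m})) (y_poly_ring n) \<and>
           P = Idl\<^bsub>A_alg q n\<^esub> (x_elem q n ` {..n} \<union> (\<lambda>i. y_elem q n (\<phi> i)) ` {1..m})"
proof -
  let ?A = "A_alg q n" and ?R = "y_poly_ring n :: ((nat \<Rightarrow>\<^sub>0 nat) \<Rightarrow>\<^sub>0 'k) ring"
  interpret A: ring ?A by (rule ring_A_alg)
  interpret h: ring_hom_ring ?R ?A "y_elem q n" by (rule y_elem_ring_hom)
  have P: "ideal P ?A"
    using assms(3) by (simp add: nc_prime_ideal_def)
  let ?J = "{\<phi> \<in> carrier ?R. y_elem q n \<phi> \<in> P}"
  have J: "primeideal ?J ?R"
    by (rule nc_prime_ideal_vimage[OF y_elem_ring_hom _ assms(3)])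
      (simp add: y_poly_ring_def cring_poly_algebra)
  have "noetherian_ring ?R"
    unfolding y_poly_ring_def by (rule noetherian_poly_algebra) simp
  then obtain G where G: "G \<subseteq> carrier ?R" "finite G" "?J = Idl\<^bsub>?R\<^esub> G"
    using noetherian_ring.finetely_gen[OF _ primeideal.axioms(1)[OF J]] by blast
  obtain \<phi> where \<phi>: "\<phi> ` {1..card G} = G"
    using ex_bij_betw_nat_finite_1[OF G(2)] by (auto simp: bij_betw_def)
  let ?S = "x_elem q n ` {..n} \<union> y_elem q n ` G"
  let ?I = "Idl\<^bsub>?A\<^esub> ?S"
  have x: "x_elem q n ` {..n} \<subseteq> carrier ?A"
  proof -
    interpret c: ring_hom_ring "B_alg n" ?A "A_class q n" by (rule A_class_ring_hom)
    show ?thesis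
      by (auto simp: x_elem_def free_var_def intro!: c.hom_closed single_in_B_alg)
  qed
  have S: "?S \<subseteq> carrier ?A"
    using x G(1) by auto
  have I: "ideal ?I ?A" and SI: "?S \<subseteq> ?I"
    by (rule A.genideal_ideal[OF S], rule A.genideal_self[OF S])
  have "x_elem q n ` {..n} \<subseteq> P"
    using A.genideal_self[OF x] assms(4) by blast
  moreover have GJ: "G \<subseteq> ?J"
    unfolding G(3) by (rule h.R.genideal_self[OF G(1)])
  ultimately have sub: "?I \<subseteq> P"
    by (intro A.genideal_minimal[OF P]) auto
  have y: "y_elem q n \<psi> \<in> ?I" if "\<psi> \<in> carrier ?R" "y_elem q n \<psi> \<in> P" for \<psi>
  proof -
    \<comment> \<open>The polynomials sent into \<open>?I\<close> form an ideal that contains \<open>G\<close>, hence all of \<open>?J\<close>.\<close>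
    have "Idl\<^bsub>?R\<^esub> G \<subseteq> {\<phi> \<in> carrier ?R. y_elem q n \<phi> \<in> ?I}"
      using SI G(1) by (intro h.R.genideal_minimal[OF h.ideal_vimage[OF I]]) auto
    with that show ?thesis
      unfolding G(3)[symmetric] by auto
  qed
  have x_I: "x_elem q n ` {..n} \<subseteq> ?I"
    using SI by simp
  have I_eq: "?I = P"
    by (rule ideal_determined_by_y_elem[OF I P sub x_I y])
  have y_image: "(\<lambda>i. y_elem q n (\<phi> i)) ` {1..card G} = y_elem q n ` G"
    using image_image[of "y_elem q n" \<phi> "{1..card G}"] unfolding \<phi> by (rule sym)
  show ?thesis
    by (rule exI[of _ "card G"], rule exI[of _ \<phi>], unfold y_image \<phi>,
        intro conjI G(1) J[unfolded G(3)] I_eq[symmetric])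
qed

end
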